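(* For two-qubit states $\rho,\sigma$ define $$W(\rho,\sigma)=N(\rho^{\Gamma_-})+\tfrac12N(\rho)-\mathrm{Tr}[F_-\sigma^{\Gamma_-}],\qquad W_C(\rho,\sigma)=C(\rho)-C(\sigma),\qquad W_N(\rho,\sigma)=N(\rho)-N(\sigma),$$ where $C$ is the concurrence and $N$ the negativity. Then neither of the witnesses $W$ and $W_C$ is better than the other, i.e. $W\not\succeq W_C$ and $W_C\not\succeq W$: (i) there exist two-qubit states $\rho,\sigma$ with $W_C(\rho,\sigma)<0$ and $W(\rho,\sigma)\ge0$; (ii) there exist two-qubit states $\rho,\sigma$ with $W(\rho,\sigma)<0$ and $W_C(\rho,\sigma)\ge0$. Moreover, there exist two-qubit states $\rho,\sigma$ with $W(\rho,\sigma)<0$ for which both $W_C(\rho,\sigma)\ge0$ and $W_N(\rho,\sigma)\ge0$.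
   Context: A two-qubit state is a positive semidefinite trace-one operator on $\mathbb{C}^2\otimes\mathbb{C}^2$. For a Hermitian operator $A$, $A=A_+-A_-$ denotes the unique decomposition with $A_\pm\ge0$ and $A_+A_-=0$. $\rho^\Gamma$ is the partial transpose with respect to the second subsystem (in the computational basis) and $\rho^{\Gamma_-}=(\rho^\Gamma)_-$. The negativity of a positive semidefinite operator $\rho$ (not necessarily normalized) is $N(\rho)=\mathrm{Tr}[\rho^{\Gamma_-}]$, so $N(\rho^{\Gamma_-})=\mathrm{Tr}[((\rho^{\Gamma_-})^\Gamma)_-]$. Here $F_-=|\psi^-_{01}\rangle\langle\psi^-_{01}|$ with $|\psi^-_{01}\rangle=\frac1{\sqrt2}(|01\rangle-|10\rangle)$. The concurrence of a two-qubit state is $C(\rho)=\max\{0,\sqrt{\mu_1}-\sqrt{\mu_2}-\sqrt{\mu_3}-\sqrt{\mu_4}\}$, where $\mu_1\ge\mu_2\ge\mu_3\ge\mu_4$ are the eigenvalues of $\rho\,(\sigma_y\otimes\sigma_y)\overline{\rho}(\sigma_y\otimes\sigma_y)$, with $\sigma_y=\begin{pmatrix}0&-i\\ i&0\end{pmatrix}$ and $\overline{\rho}$ the entrywise complex conjugate of $\rho$. (The entanglement of formation is a strictly increasing function of $C$.) For functions $W_1,W_2$ of pairs of states, $W_1\succeq W_2$ means that $W_2(\rho,\sigma)<0$ implies $W_1(\rho,\sigma)<0$ for all $\rho,\sigma$. *)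

theory Defs
  imports "Jordan_Normal_Form.Char_Poly" "HOL-Library.Multiset"
begin

text \<open>
  Operators on the two-qubit space are complex 4-by-4 matrices with respect to the computational
  basis; the basis vector \<open>|ij\<rangle>\<close> has index \<open>2 * i + j\<close>, which is the
  convention of the Kronecker products below.
\<close>

definition mat_trace :: "complex mat \<Rightarrow> complex" where
  "mat_trace A = sum_list (diag_mat A)"

text \<open>
  The order on complex numbers is the one of \<open>HOL-Library.Complex_Order\<close>, so the inequality
  includes that the quadratic form is real; in particular \<open>A\<close> is Hermitian. (The relation
  \<open>\<le>\<close> on type \<open>mat\<close> is the entrywise order and is not the one meant here.)
\<close>

definition psd :: "nat \<Rightarrow> complex mat \<Rightarrow> bool" where
  "psd n A \<longleftrightarrow> A \<in> carrier_mat n n \<and> (\<forall>v \<in> carrier_vec n. 0 \<le> (A *\<^sub>v v) \<bullet>c v)"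

definition two_qubit_state :: "complex mat \<Rightarrow> bool" where
  "two_qubit_state \<rho> \<longleftrightarrow> psd 4 \<rho> \<and> mat_trace \<rho> = 1"

text \<open>
  For Hermitian \<open>A\<close> the decomposition \<open>A = P - M\<close> exists and is unique.
\<close>

definition neg_part :: "complex mat \<Rightarrow> complex mat" where
  "neg_part A = (THE M. \<exists>P. psd (dim_row A) P \<and> psd (dim_row A) M \<and> A = P - M \<and>
                        P * M = 0\<^sub>m (dim_row A) (dim_row A))"

text \<open>
  \<open>\<langle>ij|A\<^sup>\<Gamma>|kl\<rangle> = \<langle>il|A|kj\<rangle>\<close>, where
  \<open>r = 2 * i + j\<close> and \<open>c = 2 * k + l\<close>.
\<close>

definition partial_transpose :: "complex mat \<Rightarrow> complex mat" where
  "partial_transpose A =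
     mat 4 4 (\<lambda>(r, c). A $$ (2 * (r div 2) + c mod 2, 2 * (c div 2) + r mod 2))"

definition pt_neg :: "complex mat \<Rightarrow> complex mat" where
  "pt_neg \<rho> = neg_part (partial_transpose \<rho>)"

text \<open>The trace is real here; \<open>Re\<close> is only a coercion.\<close>

definition negativity :: "complex mat \<Rightarrow> real" where
  "negativity \<rho> = Re (mat_trace (pt_neg \<rho>))"

definition kron :: "complex mat \<Rightarrow> complex mat \<Rightarrow> complex mat" where
  "kron A B = mat (dim_row A * dim_row B) (dim_col A * dim_col B)
     (\<lambda>(i, j). A $$ (i div dim_row B, j div dim_col B) * B $$ (i mod dim_row B, j mod dim_col B))"

definition kron_vec :: "complex vec \<Rightarrow> complex vec \<Rightarrow> complex vec" where
  "kron_vec u v = vec (dim_vec u * dim_vec v) (\<lambda>i. u $ (i div dim_vec v) * v $ (i mod dim_vec v))"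

lemma partial_transpose_kron:
  assumes "A \<in> carrier_mat 2 2" "B \<in> carrier_mat 2 2"
  shows "partial_transpose (kron A B) = kron A (transpose_mat B)"
proof -
  have "2 * (r div 2) + c mod 2 < 4" if "r < 4" for r c :: nat
    using that by presburger
  then show ?thesis
    using assms by (auto simp: partial_transpose_def kron_def intro!: eq_matI)
qed

definition ket :: "nat \<Rightarrow> nat \<Rightarrow> complex vec" where
  "ket i j = kron_vec (unit_vec 2 i) (unit_vec 2 j)"

definition psi_minus :: "complex vec" where
  "psi_minus = complex_of_real (1 / sqrt 2) \<cdot>\<^sub>v (ket 0 1 - ket 1 0)"

definition ketbra :: "complex vec \<Rightarrow> complex mat" where
  "ketbra v = mat (dim_vec v) (dim_vec v) (\<lambda>(i, j). v $ i * cnj (v $ j))"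

definition F_minus :: "complex mat" where
  "F_minus = ketbra psi_minus"

definition sigma_y :: "complex mat" where
  "sigma_y = mat_of_rows_list 2 [[0, - \<i>], [\<i>, 0]]"

text \<open>
  Eigenvalues in decreasing order, repeated according to algebraic multiplicity, for a matrix all
  of whose eigenvalues are real. This is the case for the matrix in \<open>concurrence\<close>, a product
  of two positive semidefinite matrices.
\<close>

definition eigvals_desc :: "complex mat \<Rightarrow> real list" where
  "eigvals_desc A = rev (sorted_list_of_multiset (image_mset Re (proots (char_poly A))))"

definition concurrence :: "complex mat \<Rightarrow> real" where
  "concurrence \<rho> =
     (let \<mu> = eigvals_desc (\<rho> * kron sigma_y sigma_y * map_mat cnj \<rho> * kron sigma_y sigma_y)
      in max 0 (sqrt (\<mu> ! 0) - sqrt (\<mu> ! 1) - sqrt (\<mu> ! 2) - sqrt (\<mu> ! 3)))"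

definition W :: "complex mat \<Rightarrow> complex mat \<Rightarrow> real" where
  "W \<rho> \<sigma> = negativity (pt_neg \<rho>) + 1 / 2 * negativity \<rho> - Re (mat_trace (F_minus * pt_neg \<sigma>))"

definition W_C :: "complex mat \<Rightarrow> complex mat \<Rightarrow> real" where
  "W_C \<rho> \<sigma> = concurrence \<rho> - concurrence \<sigma>"

definition W_N :: "complex mat \<Rightarrow> complex mat \<Rightarrow> real" where
  "W_N \<rho> \<sigma> = negativity \<rho> - negativity \<sigma>"

definition better ::
  "(complex mat \<Rightarrow> complex mat \<Rightarrow> real) \<Rightarrow> (complex mat \<Rightarrow> complex mat \<Rightarrow> real) \<Rightarrow> bool" where
  "better W1 W2 \<longleftrightarrow>
     (\<forall>\<rho> \<sigma>. two_qubit_state \<rho> \<longrightarrow> two_qubit_state \<sigma> \<longrightarrow> W2 \<rho> \<sigma> < 0 \<longrightarrow> W1 \<rho> \<sigma> < 0)"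

end

(*
  All states used have X shape: nonzero entries only on the two diagonals. Partial transposition
  exchanges the two off-diagonal parameters of a real X matrix, and its negative part can be
  written down.

  (i) Take a product state and the Bell state (|00> - |11>)/sqrt 2. The negative part of the partial
  transpose of the latter is orthogonal to the singlet, so W does not see its entanglement.

  (ii) For rho = 4/7 Phi+ + 3/7 |01><01| one has N = 1/7 and C = 4/7, and the negative eigenvector
  of the partial transpose is proportional to |01> - 2 |10>, so it is not maximally entangled and
  N(rho^Gamma_-) + N(rho)/2 = 9/70 is less than N(rho). For sigma choose an X state with the same
  N = 1/7, with C = 2/7, and with the singlet as negative eigenvector: then W = 9/70 - 1/7 < 0.
*)
theory Submission
  imports Defs "Jordan_Normal_Form.Schur_Decomposition"
begin

section \<open>Uniqueness of the positive and negative parts\<close>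

lemma psd_carrier: "psd n A \<Longrightarrow> A \<in> carrier_mat n n"
  by (simp add: psd_def)

lemma psd_form_real:
  assumes "psd n A" "v \<in> carrier_vec n"
  shows "Im ((A *\<^sub>v v) \<bullet>c v) = 0" "0 \<le> Re ((A *\<^sub>v v) \<bullet>c v)"
  using assms by (auto simp: psd_def less_eq_complex_def)

lemma conjugate_form:
  fixes u v :: "complex vec"
  assumes "u \<in> carrier_vec n" "v \<in> carrier_vec n"
  shows "cnj (u \<bullet>c v) = v \<bullet>c u"
  using assms by (simp add: scalar_prod_def mult.commute)

text \<open>Polarization: the form is real at \<open>v + k w\<close> for every \<open>k\<close>, and
  \<open>k = 1\<close> and \<open>k = \<i>\<close> together force \<open>?q v w\<close> to be the
  conjugate of \<open>?q w v\<close>.\<close>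

lemma psd_hermitian:
  assumes A: "psd n A" and v: "v \<in> carrier_vec n" and w: "w \<in> carrier_vec n"
  shows "(A *\<^sub>v v) \<bullet>c w = v \<bullet>c (A *\<^sub>v w)"
proof -
  note c = psd_carrier[OF A]
  let ?q = "\<lambda>v w. (A *\<^sub>v v) \<bullet>c w"
  have expand: "?q (v + k \<cdot>\<^sub>v w) (v + k \<cdot>\<^sub>v w)
      = ?q v v + cnj k * ?q v w + k * ?q w v + k * cnj k * ?q w w" for k
    using c v w
    by (simp add: mult_add_distrib_mat_vec[of _ n n] mult_mat_vec[of _ n n] conjugate_add_vec[of _ n]
        conjugate_smult_vec add_scalar_prod_distrib[of _ n] scalar_prod_add_distrib[of _ n]
        algebra_simps)
  have real: "Im (cnj k * ?q v w + k * ?q w v) = 0" for k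
  proof -
    have "Im (?q (v + k \<cdot>\<^sub>v w) (v + k \<cdot>\<^sub>v w)) = 0"
      by (rule psd_form_real[OF A]) (use v w in auto)
    moreover have "Im (k * cnj k * ?q w w) = 0"
      using psd_form_real(1)[OF A w] by (simp add: complex_mult_cnj)
    ultimately show ?thesis
      unfolding expand plus_complex.sel using psd_form_real(1)[OF A v] by argo
  qed
  have "?q v w = cnj (?q w v)"
    using real[of 1] real[of \<i>] by (auto simp: complex_eq_iff)
  then show ?thesis
    using conjugate_form[of "A *\<^sub>v w" n v] c v w by simp
qed

lemma psd_mult_zero_form:
  assumes P: "psd n P" and M: "psd n M" and PM: "P * M = 0\<^sub>m n n" and v: "v \<in> carrier_vec n"
  shows "(P *\<^sub>v v) \<bullet>c (M *\<^sub>v v) = 0"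
proof -
  note c = psd_carrier[OF P] psd_carrier[OF M]
  have "(P *\<^sub>v v) \<bullet>c (M *\<^sub>v v) = v \<bullet>c (P *\<^sub>v (M *\<^sub>v v))"
    by (rule psd_hermitian[OF P v]) (use c v in auto)
  also have "P *\<^sub>v (M *\<^sub>v v) = 0\<^sub>v n"
    unfolding assoc_mult_mat_vec[OF c v, symmetric] PM using v by (intro eq_vecI) auto
  finally show ?thesis using v by simp
qed

text \<open>The trace of \<open>D * D\<close> is computed twice. A Schur form of \<open>D\<close>
  has zero diagonal, which makes the trace vanish; Hermiticity makes it the sum of all squared
  moduli of the entries of \<open>D\<close>.\<close>

lemma hermitian_nilpotent_eq_0:
  fixes D :: "complex mat"
  assumes D: "D \<in> carrier_mat n n"
    and herm: "\<And>i j. i < n \<Longrightarrow> j < n \<Longrightarrow> D $$ (j, i) = cnj (D $$ (i, j))"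
    and ev: "\<And>e. eigenvalue D e \<Longrightarrow> e = 0"
  shows "D = 0\<^sub>m n n"
proof -
  obtain es where es: "char_poly D = (\<Prod>a\<leftarrow>es. [:- a, 1:])"
    using char_poly_factorized[OF D] by blast
  obtain B where B: "B \<in> carrier_mat n n" and ut: "upper_triangular B" and sim: "similar_mat D B"
    using schur_decomposition_exists[OF D es] by blast
  have diag0: "B $$ (i, i) = 0" if "i < n" for i
  proof -
    have "poly (char_poly B) (B $$ (i, i)) = 0"
      using B that by (auto simp: char_poly_upper_triangular[OF B ut] poly_prod_list prod_list_zero_iff
          diag_mat_def image_iff intro!: bexI[of _ i])
    then show ?thesis
      using ev eigenvalue_root_char_poly[OF D] char_poly_similar[OF sim] by metis
  qed
  have tr: "mat_trace (X * Y) = (\<Sum>i<n. \<Sum>j<n. X $$ (i, j) * Y $$ (j, i))"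
    if "X \<in> carrier_mat n n" "Y \<in> carrier_mat n n" for X Y
    using that by (auto simp: mat_trace_def diag_mat_def scalar_prod_def interv_sum_list_conv_sum_set_nat
        atLeast0LessThan intro!: sum.cong)
  have tr_comm: "mat_trace (X * Y) = mat_trace (Y * X)"
    if "X \<in> carrier_mat n n" "Y \<in> carrier_mat n n" for X Y
    unfolding tr[OF that] tr[OF that(2,1)] by (subst sum.swap) (simp add: mult.commute)
  obtain S T where ST: "S \<in> carrier_mat n n" "T \<in> carrier_mat n n" "T * S = 1\<^sub>m n" "D = S * B * T"
    using sim D unfolding similar_mat_def similar_mat_wit_def by (auto simp: Let_def)
  have "D * D = S * (B * B * T)"
  proof -
    have "D * D = S * B * (T * S) * (B * T)"
      unfolding ST(4) using ST(1,2) B by (simp add: assoc_mult_mat[of _ n n _ n _ n])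
    also have "\<dots> = S * (B * B * T)"
      unfolding ST(3) using ST(1,2) B by (simp add: assoc_mult_mat[of _ n n _ n _ n])
    finally show ?thesis .
  qed
  then have "mat_trace (D * D) = mat_trace (B * B * T * S)"
    using tr_comm[of S "B * B * T"] ST(1,2) B by simp
  also have "B * B * T * S = B * B"
    using ST(1-3) B by (simp add: assoc_mult_mat[of _ n n _ n _ n])
  also have "mat_trace (B * B) = 0"
  proof -
    \<comment> \<open>For distinct indices one of the two factors lies below the diagonal; otherwise
      both are on it.\<close>
    have "B $$ (i, j) * B $$ (j, i) = 0" if "i < n" "j < n" for i j
      using diag0 ut B that by (cases i j rule: linorder_cases) (auto simp: upper_triangular_def)
    then show ?thesis unfolding tr[OF B B] by (intro sum.neutral ballI) auto
  qed
  finally have "(\<Sum>i<n. \<Sum>j<n. D $$ (i, j) * D $$ (j, i)) = 0"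
    by (simp add: tr[OF D D])
  also have "(\<Sum>i<n. \<Sum>j<n. D $$ (i, j) * D $$ (j, i))
      = of_real (\<Sum>i<n. \<Sum>j<n. (cmod (D $$ (i, j)))\<^sup>2)"
    unfolding of_real_sum complex_norm_square
    by (intro sum.cong refl arg_cong2[where f = "(*)"] herm) auto
  finally have "(\<Sum>i<n. \<Sum>j<n. (cmod (D $$ (i, j)))\<^sup>2) = 0"
    using of_real_eq_0_iff by blast
  then show ?thesis
    using D by (auto simp: sum_nonneg_eq_0_iff sum_nonneg intro!: eq_matI)
qed

text \<open>
  Suppose \<open>D = M - M' = P - P'\<close> has an eigenvector \<open>v\<close> with eigenvalue \<open>\<delta> \<noteq> 0\<close>. Pairing
  \<open>Pv = P'v + \<delta>v\<close> with \<open>Mv = M'v + \<delta>v\<close> and using \<open>PM = P'M' = 0\<close> makes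
  \<open>\<langle>P'v,v\<rangle> + \<langle>M'v,v\<rangle> + \<delta>\<langle>v,v\<rangle>\<close> vanish, so \<open>\<delta> < 0\<close>. But this sum is
  also \<open>\<langle>Pv,v\<rangle> + \<langle>M'v,v\<rangle>\<close>, so \<open>\<langle>M'v,v\<rangle> = 0\<close> and
  \<open>\<delta>\<langle>v,v\<rangle> = \<langle>Mv,v\<rangle> \<ge> 0\<close>.
\<close>

lemma psd_decomposition_unique:
  assumes P: "psd n P" and M: "psd n M" and PM: "P * M = 0\<^sub>m n n"
    and P': "psd n P'" and M': "psd n M'" and PM': "P' * M' = 0\<^sub>m n n"
    and eq: "P - M = P' - M'"
  shows "M = M'"
proof -
  note c = psd_carrier[OF P] psd_carrier[OF M] psd_carrier[OF P'] psd_carrier[OF M']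
  let ?D = "M - M'"
  have entry: "P $$ (i, j) - M $$ (i, j) = P' $$ (i, j) - M' $$ (i, j)" if "i < n" "j < n" for i j
    using arg_cong[OF eq, of "\<lambda>A. A $$ (i, j)"] c that by simp
  have DP: "?D = P - P'"
    using c entry by (intro eq_matI) (auto simp: algebra_simps)
  have D: "?D \<in> carrier_mat n n" using c by auto
  have herm: "A $$ (j, i) = cnj (A $$ (i, j))" if A: "psd n A" and "i < n" "j < n" for A i j
  proof -
    note cA = psd_carrier[OF A]
    have "cnj ((A *\<^sub>v unit_vec n j) \<bullet>c unit_vec n i) = cnj (unit_vec n j \<bullet>c (A *\<^sub>v unit_vec n i))"
      by (simp add: psd_hermitian[OF A])
    also have "\<dots> = (A *\<^sub>v unit_vec n i) \<bullet>c unit_vec n j"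
      using cA by (intro conjugate_form[of _ n]) auto
    moreover have "(A *\<^sub>v unit_vec n k) \<bullet>c unit_vec n l = A $$ (l, k)" if "k < n" "l < n" for k l
    proof -
      have "conjugate (unit_vec n l) = (unit_vec n l :: complex vec)"
        by (auto simp: unit_vec_def)
      then show ?thesis using cA that by simp
    qed
    ultimately show ?thesis using that by simp
  qed
  have "e = 0" if ev: "eigenvalue ?D e" for e
  proof (rule ccontr)
    assume "e \<noteq> 0"
    obtain v where v: "v \<in> carrier_vec n" and v0: "v \<noteq> 0\<^sub>v n" and ve: "?D *\<^sub>v v = e \<cdot>\<^sub>v v"
      using ev D unfolding eigenvalue_def eigenvector_def by auto
    let ?p = "(P *\<^sub>v v) \<bullet>c v" and ?m = "(M *\<^sub>v v) \<bullet>c v"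
      and ?p' = "(P' *\<^sub>v v) \<bullet>c v" and ?m' = "(M' *\<^sub>v v) \<bullet>c v" and ?s = "v \<bullet>c v"
    have shift: "A *\<^sub>v v = B *\<^sub>v v + e \<cdot>\<^sub>v v"
      if "A \<in> carrier_mat n n" "B \<in> carrier_mat n n" "(A - B) *\<^sub>v v = e \<cdot>\<^sub>v v" for A B
      unfolding that(3)[symmetric] minus_mult_distrib_mat_vec[OF that(1,2) v]
      using that(1,2) by (intro eq_vecI) auto
    have Mv: "M *\<^sub>v v = M' *\<^sub>v v + e \<cdot>\<^sub>v v"
      by (rule shift[OF c(2,4) ve])
    have Pv: "P *\<^sub>v v = P' *\<^sub>v v + e \<cdot>\<^sub>v v"
      by (rule shift[OF c(1,3) ve[unfolded DP]])
    have s: "0 < Re ?s" "Im ?s = 0"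
      using conjugate_square_greater_0_vec[OF v] v0 by (auto simp: less_complex_def)
    have m: "?m = ?m' + e * ?s" and p: "?p = ?p' + e * ?s"
      unfolding Mv Pv using c v by (simp_all add: add_scalar_prod_distrib[of _ n])
    note re = psd_form_real[OF P v] psd_form_real[OF M v] psd_form_real[OF P' v] psd_form_real[OF M' v]
    \<comment> \<open>All forms are real and \<open>?s\<close> is positive, so \<open>e\<close> is
      real; \<open>cnj e\<close> below then equals \<open>e\<close>, which can be factored
      out.\<close>
    have "Im e * Re ?s = 0" using arg_cong[OF m, of Im] s re by simp
    then have ime: "Im e = 0" using s by simp
    have "0 = (P *\<^sub>v v) \<bullet>c (M *\<^sub>v v)"
      using psd_mult_zero_form[OF P M PM v] by simp
    also have "\<dots> = (P' *\<^sub>v v) \<bullet>c (M' *\<^sub>v v) + cnj e * ?p' + e * (v \<bullet>c (M' *\<^sub>v v)) + e * cnj e * ?s"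
      unfolding Mv Pv using c v
      by (simp add: add_scalar_prod_distrib[of _ n] scalar_prod_add_distrib[of _ n]
          conjugate_add_vec[of _ n] conjugate_smult_vec algebra_simps)
    also have "\<dots> = e * (?p' + ?m' + e * ?s)"
      using psd_mult_zero_form[OF P' M' PM' v] psd_hermitian[OF M' v v] ime
      by (simp add: complex_eq_iff algebra_simps)
    finally have "?p' + ?m' + e * ?s = 0" using \<open>e \<noteq> 0\<close> by simp
    then have sum0: "Re ?p' + Re ?m' + Re e * Re ?s = 0"
      using s by (simp add: complex_eq_iff)
    have "Re ?m = Re ?m' + Re e * Re ?s" "Re ?p = Re ?p' + Re e * Re ?s"
      using arg_cong[OF m, of Re] arg_cong[OF p, of Re] s by simp_all
    then have "Re e * Re ?s = 0" using sum0 re by linarith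
    then show False using \<open>e \<noteq> 0\<close> ime s by (simp add: complex_eq_iff)
  qed
  moreover have "?D $$ (j, i) = cnj (?D $$ (i, j))" if "i < n" "j < n" for i j
    using herm[OF M that] herm[OF M' that] c that by simp
  ultimately have "?D = 0\<^sub>m n n"
    by (intro hermitian_nilpotent_eq_0[OF D])
  then have "M $$ (i, j) - M' $$ (i, j) = 0" if "i < n" "j < n" for i j
    using c that by (metis index_minus_mat(1) index_zero_mat(1) carrier_matD)
  then show ?thesis using c by (intro eq_matI) auto
qed

text \<open>Replaces the definite description by a certificate: any orthogonal pair of psd matrices
  with the right difference identifies the negative part.\<close>

lemma neg_part_eqI:
  assumes "psd n P" "psd n M" "P * M = 0\<^sub>m n n" "A = P - M"
  shows "neg_part A = M"
proof -
  have dim: "dim_row A = n" using assms psd_carrier by fastforce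
  show ?thesis
    unfolding neg_part_def dim
  proof (rule the_equality)
    show "\<exists>P. psd n P \<and> psd n M \<and> A = P - M \<and> P * M = 0\<^sub>m n n" using assms by blast
  next
    fix M' assume "\<exists>P'. psd n P' \<and> psd n M' \<and> A = P' - M' \<and> P' * M' = 0\<^sub>m n n"
    then show "M' = M" using psd_decomposition_unique assms by metis
  qed
qed

section \<open>Real X states\<close>

text \<open>A direct sum of two real symmetric blocks: \<open>a, z, d\<close> on the span of |00>,
  |11> (outer) and \<open>b, w, c\<close> on the span of |01>, |10> (inner).\<close>

definition xmat :: "real \<Rightarrow> real \<Rightarrow> real \<Rightarrow> real \<Rightarrow> real \<Rightarrow> real \<Rightarrow> complex mat" where
  "xmat a b c d z w = mat 4 4 (\<lambda>(i, j). of_real (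
     [[a, 0, 0, z],
      [0, b, w, 0],
      [0, w, c, 0],
      [z, 0, 0, d]] ! i ! j))"

lemma lessThan_4: "{0..<4 :: nat} = {0, 1, 2, 3}" by auto

lemma less_4_iff: "i < (4 :: nat) \<longleftrightarrow> i = 0 \<or> i = 1 \<or> i = 2 \<or> i = 3" by auto

lemma eq_mat_4I:
  assumes "A \<in> carrier_mat 4 4" "B \<in> carrier_mat 4 4"
    and "\<forall>i\<in>{0, 1, 2, 3}. \<forall>j\<in>{0, 1, 2, 3}. A $$ (i, j) = B $$ (i, j)"
  shows "A = B"
  using assms by (intro eq_matI) (auto simp: less_4_iff)

lemma xmat_carrier [simp]: "xmat a b c d z w \<in> carrier_mat 4 4"
  by (simp add: xmat_def)

lemma xmat_dim [simp]: "dim_row (xmat a b c d z w) = 4" "dim_col (xmat a b c d z w) = 4"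
  by (simp_all add: xmat_def)

lemma xmat_index:
  "i < 4 \<Longrightarrow> j < 4 \<Longrightarrow> xmat a b c d z w $$ (i, j) = complex_of_real
     ([[a, 0, 0, z], [0, b, w, 0], [0, w, c, 0], [z, 0, 0, d]] ! i ! j)"
  by (simp add: xmat_def)

lemma mult_index_4:
  assumes "A \<in> carrier_mat 4 4" "B \<in> carrier_mat 4 4" "i < 4" "j < 4"
  shows "(A * B) $$ (i, j) = A $$ (i, 0) * B $$ (0, j) + A $$ (i, 1) * B $$ (1, j)
    + A $$ (i, 2) * B $$ (2, j) + A $$ (i, 3) * B $$ (3, j)"
  using assms by (simp add: scalar_prod_def lessThan_4 add.assoc)

lemma mult_carrier_4 [simp]:
  "A \<in> carrier_mat 4 4 \<Longrightarrow> B \<in> carrier_mat 4 4 \<Longrightarrow> A * B \<in> carrier_mat 4 4"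
  by (rule mult_carrier_mat)

lemma mat_trace_4:
  assumes "A \<in> carrier_mat 4 4"
  shows "mat_trace A = A $$ (0, 0) + A $$ (1, 1) + A $$ (2, 2) + A $$ (3, 3)"
  using assms by (simp add: mat_trace_def diag_mat_def upt_rec numeral_eq_Suc)

lemma mat_trace_xmat: "mat_trace (xmat a b c d z w) = of_real (a + b + c + d)"
  by (simp add: mat_trace_4 xmat_index)

lemma partial_transpose_xmat: "partial_transpose (xmat a b c d z w) = xmat a b c d w z"
  by (rule eq_mat_4I) (auto simp: partial_transpose_def xmat_index)

text \<open>Multiplying by \<open>a\<close> completes the square; if \<open>a = 0\<close>, the
  determinant condition forces \<open>z = 0\<close>.\<close>

lemma real_form_2_nonneg:
  fixes a d z :: real and x y :: complex
  assumes "0 \<le> a" "0 \<le> d" "z\<^sup>2 \<le> a * d"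
  shows "0 \<le> a * (cmod x)\<^sup>2 + d * (cmod y)\<^sup>2 + 2 * z * Re (x * cnj y)"
proof (cases "a = 0")
  case True
  with assms show ?thesis by simp
next
  case False
  have "a * (a * (cmod x)\<^sup>2 + d * (cmod y)\<^sup>2 + 2 * z * Re (x * cnj y))
      = (cmod (a * x + z * y))\<^sup>2 + (a * d - z\<^sup>2) * (cmod y)\<^sup>2"
    unfolding cmod_power2 by (simp add: power2_eq_square algebra_simps)
  also have "\<dots> \<ge> 0" using assms by simp
  finally show ?thesis using False assms by (simp add: zero_le_mult_iff)
qed

lemma psd_xmat:
  assumes "0 \<le> a" "0 \<le> b" "0 \<le> c" "0 \<le> d" "z\<^sup>2 \<le> a * d" "w\<^sup>2 \<le> b * c"
  shows "psd 4 (xmat a b c d z w)"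
  unfolding psd_def
proof (intro conjI ballI)
  fix v :: "complex vec" assume v: "v \<in> carrier_vec 4"
  have "(xmat a b c d z w *\<^sub>v v) \<bullet>c v = of_real
      ((a * (cmod (v $ 0))\<^sup>2 + d * (cmod (v $ 3))\<^sup>2 + 2 * z * Re (v $ 0 * cnj (v $ 3)))
      + (b * (cmod (v $ 1))\<^sup>2 + c * (cmod (v $ 2))\<^sup>2 + 2 * w * Re (v $ 1 * cnj (v $ 2))))"
    using v unfolding cmod_power2
    by (simp add: scalar_prod_def lessThan_4 xmat_index complex_eq_iff power2_eq_square algebra_simps)
  also have "\<dots> \<ge> 0"
    unfolding less_eq_complex_def Re_complex_of_real Im_complex_of_real zero_complex.sel
    using assms by (intro conjI refl add_nonneg_nonneg real_form_2_nonneg)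
  finally show "0 \<le> (xmat a b c d z w *\<^sub>v v) \<bullet>c v" .
qed simp

lemma two_qubit_state_xmat:
  assumes "0 \<le> a" "0 \<le> b" "0 \<le> c" "0 \<le> d" "z\<^sup>2 \<le> a * d" "w\<^sup>2 \<le> b * c" "a + b + c + d = 1"
  shows "two_qubit_state (xmat a b c d z w)"
  unfolding two_qubit_state_def mat_trace_xmat using assms by (simp add: psd_xmat)

text \<open>The unprimed matrix is the positive part. The eight equations say that the products of
  corresponding blocks vanish, four for the outer block and four for the inner one.\<close>

lemma neg_part_xmat:
  assumes "psd 4 (xmat a b c d z w)" "psd 4 (xmat a' b' c' d' z' w')"
    and "a * a' + z * z' = 0" "a * z' + z * d' = 0" "z * a' + d * z' = 0" "z * z' + d * d' = 0"
    and "b * b' + w * w' = 0" "b * w' + w * c' = 0" "w * b' + c * w' = 0" "w * w' + c * c' = 0"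
  shows "neg_part (xmat (a - a') (b - b') (c - c') (d - d') (z - z') (w - w')) = xmat a' b' c' d' z' w'"
proof (rule neg_part_eqI[OF assms(1,2)])
  show "xmat a b c d z w * xmat a' b' c' d' z' w' = 0\<^sub>m 4 4"
    using assms(3-)
    by (intro eq_mat_4I) (auto simp: mult_index_4 xmat_index simp flip: of_real_mult of_real_add
        simp del: of_real_eq_0_iff index_mult_mat)
  show "xmat (a - a') (b - b') (c - c') (d - d') (z - z') (w - w')
      = xmat a b c d z w - xmat a' b' c' d' z' w'"
    by (rule eq_mat_4I) (auto simp: xmat_index)
qed

lemma F_minus_xmat: "F_minus = xmat 0 (1/2) (1/2) 0 0 (-1/2)"
proof -
  have "complex_of_real (sqrt 2) * complex_of_real (sqrt 2) = 2"
    by (simp flip: of_real_mult)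
  then show ?thesis
    unfolding F_minus_def ketbra_def psi_minus_def ket_def kron_vec_def
    by (intro eq_mat_4I) (auto simp: xmat_index unit_vec_def)
qed

lemma mat_trace_F_minus_xmat:
  "mat_trace (F_minus * xmat a b c d z w) = of_real ((b + c) / 2 - w)"
  unfolding F_minus_xmat
  by (subst mat_trace_4) (simp_all add: mult_index_4 xmat_index field_simps del: index_mult_mat)

lemma sigma_y_carrier [simp]: "dim_row sigma_y = 2" "dim_col sigma_y = 2"
  by (simp_all add: sigma_y_def mat_of_rows_list_def)

lemma sigma_y_index:
  "i < 2 \<Longrightarrow> j < 2 \<Longrightarrow> sigma_y $$ (i, j) = [[0, - \<i>], [\<i>, 0]] ! i ! j"
  by (simp add: sigma_y_def mat_of_rows_list_def)

lemma kron_sigma_y: "kron sigma_y sigma_y = xmat 0 0 0 0 (-1) 1"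
  by (rule eq_mat_4I) (auto simp: kron_def sigma_y_index xmat_index)

section \<open>Characteristic polynomials and concurrence\<close>

text \<open>Laplace expansion along the first row, with minors written again as explicit
  \<open>mat n n\<close> terms so that it can be iterated down to size 0.\<close>

lemma det_mat_Suc:
  fixes f :: "nat \<times> nat \<Rightarrow> 'a :: comm_ring_1"
  shows "det (mat (Suc n) (Suc n) f) = (\<Sum>j<Suc n. f (0, j) * (- 1) ^ j *
    det (mat n n (\<lambda>(i, k). f (Suc i, if k < j then k else Suc k))))"
proof -
  let ?A = "mat (Suc n) (Suc n) f"
  have "mat_delete ?A 0 j = mat n n (\<lambda>(i, k). f (Suc i, if k < j then k else Suc k))"
    if "j < Suc n" for j
    using that by (intro eq_matI) (auto simp: mat_delete_def)
  then show ?thesis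
    by (subst laplace_expansion_row[of _ "Suc n" 0]) (auto simp: cofactor_def mult.assoc intro!: sum.cong)
qed

lemma char_poly_eq_det_mat:
  assumes "A \<in> carrier_mat n n"
  shows "char_poly A = det (mat n n (\<lambda>(i, j). if i = j then [:- (A $$ (i, j)), 1:] else [:- (A $$ (i, j)):]))"
  unfolding char_poly_def char_poly_matrix_def using assms
  by (intro arg_cong[of _ _ det] eq_matI) auto

text \<open>The outer block contributes \<open>(x - p)^2 - q * r\<close>, which splits once a square
  root \<open>t\<close> of \<open>q * r\<close> is given; the zero inner block contributes
  \<open>x^2\<close>.\<close>

lemma char_poly_corner_block:
  fixes A :: "'a :: field mat"
  assumes "A = mat 4 4 (\<lambda>(i, j). [[p, 0, 0, q], [0, 0, 0, 0], [0, 0, 0, 0], [r, 0, 0, p]] ! i ! j)"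
    and "q * r = t\<^sup>2"
  shows "char_poly A = [:- (p + t), 1:] * [:- (p - t), 1:] * [:0, 1:] * [:0, 1:]"
proof -
  have "A \<in> carrier_mat 4 4" using assms by simp
  from char_poly_eq_det_mat[OF this]
  have "char_poly A = [:0, 1:] * [:0, 1:] * ([:- p, 1:] * [:- p, 1:] - [:q * r:])"
    by (simp add: assms(1) det_mat_Suc numeral_eq_Suc algebra_simps)
  then show ?thesis
    unfolding assms(2) by (simp add: algebra_simps power2_eq_square)
qed

text \<open>The spin flip swaps the diagonal of the inner block, so with \<open>c = w = 0\<close>
  that block drops out. The outer block has eigenvalues \<open>(s + \<bar>z\<bar>)^2\<close> and
  \<open>(s - \<bar>z\<bar>)^2\<close>; as \<open>\<bar>z\<bar> \<le> s\<close>, their roots differ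
  by \<open>2 * \<bar>z\<bar>\<close>.\<close>

lemma concurrence_xmat:
  assumes "a * d = s\<^sup>2" "\<bar>z\<bar> \<le> s"
  shows "concurrence (xmat a b 0 d z 0) = 2 * \<bar>z\<bar>"
proof -
  let ?\<rho> = "xmat a b 0 d z 0" and ?K = "kron sigma_y sigma_y"
  let ?R = "?\<rho> * ?K * map_mat cnj ?\<rho> * ?K"
  have conj: "map_mat cnj ?\<rho> = ?\<rho>"
    by (rule eq_matI) (simp_all add: xmat_index)
  have R: "?R = mat 4 4 (\<lambda>(i, j). [[of_real (a * d + z\<^sup>2), 0, 0, of_real (2 * a * z)], [0, 0, 0, 0],
      [0, 0, 0, 0], [of_real (2 * d * z), 0, 0, of_real (a * d + z\<^sup>2)]] ! i ! j)"
    unfolding conj kron_sigma_y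
    by (rule eq_mat_4I) (simp_all add: mult_index_4 xmat_index power2_eq_square algebra_simps
        del: index_mult_mat)
  have "complex_of_real (2 * a * z) * of_real (2 * d * z) = (of_real (2 * s * \<bar>z\<bar>))\<^sup>2"
    using assms(1) by (simp add: power_mult_distrib flip: of_real_mult of_real_power)
      (simp add: power2_eq_square algebra_simps)
  from char_poly_corner_block[OF R this]
  have "char_poly ?R = [:- of_real ((s + \<bar>z\<bar>)\<^sup>2), 1:] * [:- of_real ((s - \<bar>z\<bar>)\<^sup>2), 1:] * [:0, 1:] * [:0, 1:]"
    using assms(1) by (simp add: power2_sum power2_diff add.commute)
  then have "image_mset Re (proots (char_poly ?R)) = mset [0, 0, (s - \<bar>z\<bar>)\<^sup>2, (s + \<bar>z\<bar>)\<^sup>2]"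
    by (simp add: proots_mult del: mult_pCons_left mult_pCons_right)
  moreover have "sort [0, 0, (s - \<bar>z\<bar>)\<^sup>2, (s + \<bar>z\<bar>)\<^sup>2] = [0, 0, (s - \<bar>z\<bar>)\<^sup>2, (s + \<bar>z\<bar>)\<^sup>2]"
    using assms(2) by (intro sorted_sort_id) (auto intro: power_mono)
  ultimately have "eigvals_desc ?R = [(s + \<bar>z\<bar>)\<^sup>2, (s - \<bar>z\<bar>)\<^sup>2, 0, 0]"
    by (simp add: eigvals_desc_def del: mset.simps sort_key_simps)
  then show ?thesis
    unfolding concurrence_def using assms(2) by simp
qed

section \<open>The two pairs of states\<close>

text \<open>The arguments supplied at each use are the positive part of the partial transpose;
  \<open>w\<close> and \<open>z\<close> trade places because the transposition has already been
  applied there.\<close>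

lemma pt_neg_xmat:
  assumes "psd 4 (xmat a b c d w z)" "psd 4 (xmat a' b' c' d' w' z')"
    and "a * a' + w * w' = 0" "a * w' + w * d' = 0" "w * a' + d * w' = 0" "w * w' + d * d' = 0"
    and "b * b' + z * z' = 0" "b * z' + z * c' = 0" "z * b' + c * z' = 0" "z * z' + c * c' = 0"
    and "A = xmat (a - a') (b - b') (c - c') (d - d') (z - z') (w - w')"
  shows "pt_neg A = xmat a' b' c' d' w' z'"
  unfolding pt_neg_def assms(11) partial_transpose_xmat by (rule neg_part_xmat) (use assms in auto)

theorem mainTheorem4:
  shows "\<not> better W W_C \<and> \<not> better W_C W
    \<and> (\<exists>\<rho> \<sigma>. two_qubit_state \<rho> \<and> two_qubit_state \<sigma> \<and> W_C \<rho> \<sigma> < 0 \<and> W \<rho> \<sigma> \<ge> 0)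
    \<and> (\<exists>\<rho> \<sigma>. two_qubit_state \<rho> \<and> two_qubit_state \<sigma> \<and> W \<rho> \<sigma> < 0 \<and> W_C \<rho> \<sigma> \<ge> 0)
    \<and> (\<exists>\<rho> \<sigma>. two_qubit_state \<rho> \<and> two_qubit_state \<sigma>
          \<and> W \<rho> \<sigma> < 0 \<and> W_C \<rho> \<sigma> \<ge> 0 \<and> W_N \<rho> \<sigma> \<ge> 0)"
proof -
  have product_and_bell: "\<exists>\<rho> \<sigma>. two_qubit_state \<rho> \<and> two_qubit_state \<sigma> \<and> W_C \<rho> \<sigma> < 0 \<and> W \<rho> \<sigma> \<ge> 0"
  proof (intro exI conjI)
    let ?\<rho> = "xmat 1 0 0 0 0 0" and ?\<sigma> = "xmat (1/2) 0 0 (1/2) (-1/2) 0"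
    show "two_qubit_state ?\<rho>" "two_qubit_state ?\<sigma>"
      by (rule two_qubit_state_xmat; simp add: power2_eq_square)+
    show "W_C ?\<rho> ?\<sigma> < 0"
      using concurrence_xmat[of 1 0 0 0 0] concurrence_xmat[of "1/2" "1/2" "1/2" "-1/2" 0]
      by (simp add: W_C_def power2_eq_square)
    have "pt_neg ?\<rho> = xmat 0 0 0 0 0 0"
      by (rule pt_neg_xmat[of 1 0 0 0 0 0]) (simp_all add: psd_xmat)
    moreover have "pt_neg (xmat 0 0 0 0 0 0) = xmat 0 0 0 0 0 0"
      by (rule pt_neg_xmat[of 0 0 0 0 0 0]) (simp_all add: psd_xmat)
    \<comment> \<open>Half the projector onto (|01> + |10>)/sqrt 2; its overlap with the singlet is
      0, so \<open>W\<close> is exactly 0.\<close>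
    moreover have "pt_neg ?\<sigma> = xmat 0 (1/4) (1/4) 0 0 (1/4)"
      by (rule pt_neg_xmat[of "1/2" "1/4" "1/4" "1/2" 0 "-1/4"]) (simp_all add: psd_xmat power2_eq_square)
    ultimately show "W ?\<rho> ?\<sigma> \<ge> 0"
      by (simp add: W_def negativity_def mat_trace_xmat mat_trace_F_minus_xmat)
  qed
  have equal_negativity: "\<exists>\<rho> \<sigma>. two_qubit_state \<rho> \<and> two_qubit_state \<sigma>
      \<and> W \<rho> \<sigma> < 0 \<and> W_C \<rho> \<sigma> \<ge> 0 \<and> W_N \<rho> \<sigma> \<ge> 0"
  proof (intro exI conjI)
    let ?\<rho> = "xmat (2/7) (3/7) 0 (2/7) (2/7) 0" and ?\<sigma> = "xmat (9/10) 0 0 (1/10) (1/7) 0"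
    show "two_qubit_state ?\<rho>" "two_qubit_state ?\<sigma>"
      by (rule two_qubit_state_xmat; simp add: power2_eq_square)+
    show "W_C ?\<rho> ?\<sigma> \<ge> 0"
      \<comment> \<open>The third argument is \<open>s\<close>: here 2/7, and for
        \<open>?\<sigma>\<close> the root 3/10 of 9/10 * 1/10, which exceeds 1/7.\<close>
      using concurrence_xmat[of "2/7" "2/7" "2/7" "2/7" "3/7"]
        concurrence_xmat[of "9/10" "1/10" "3/10" "1/7" 0]
      by (simp add: W_C_def power2_eq_square)
    \<comment> \<open>The inner block has eigenvalues 4/7 and -1/7, with eigenvectors (2, 1) and (1,
      -2) of squared norm 5, hence the denominators 35.\<close>
    have 1: "pt_neg ?\<rho> = xmat 0 (1/35) (4/35) 0 0 (- (2/35))"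
      by (rule pt_neg_xmat[of "2/7" "16/35" "4/35" "2/7" 0 "8/35"]) (simp_all add: psd_xmat power2_eq_square)
    \<comment> \<open>The entry -2/35 moves to the outer corners, where its negative part has trace
      2/35; adding half of 1/7 gives 9/70.\<close>
    have 2: "pt_neg (xmat 0 (1/35) (4/35) 0 0 (- (2/35))) = xmat (1/35) 0 0 (1/35) (1/35) 0"
      by (rule pt_neg_xmat[of "1/35" "1/35" "4/35" "1/35" "-1/35" 0]) (simp_all add: psd_xmat power2_eq_square)
    have 3: "pt_neg ?\<sigma> = xmat 0 (1/14) (1/14) 0 0 (-1/14)"
      by (rule pt_neg_xmat[of "9/10" "1/14" "1/14" "1/10" 0 "1/14"]) (simp_all add: psd_xmat power2_eq_square)
    show "W ?\<rho> ?\<sigma> < 0" "W_N ?\<rho> ?\<sigma> \<ge> 0"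
      by (simp_all add: W_def W_N_def negativity_def 1 2 3 mat_trace_xmat mat_trace_F_minus_xmat)
  qed
  \<comment> \<open>The second pair serves both (ii) and the final claim, and each pair refutes one
    of the two comparisons.\<close>
  show ?thesis
    unfolding better_def using product_and_bell equal_negativity by (meson not_le)
qed

end
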